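(* Let $n_1,\dots,n_N$ be positive integers with $\sum_{i=1}^N n_i=n$ and let $X\subseteq\mathbb{R}^n$ be a non-empty closed convex set. For each $i\in\{1,\dots,N\}$ suppose that $u_i:\mathbb{R}^{n-n_i}\times\mathbb{R}^{n_i}\to\mathbb{R}$, $(x_{-i},x_i)\mapsto u_i(x_{-i},x_i)$, is continuous on $\mathbb{R}^n$ and quasiconvex with respect to $x_i$. Assume that there exists some $r'>0$ such that for each $y\in X$ with $\|y\|>r'$ there exists $z\in X$ with $\|z\|<\|y\|$ satisfying $$u_i(y_{-i},z_i)<u_i(y_{-i},y_i)\quad\text{for each }i\in\{1,\dots,N\}.$$ Then the jointly convex generalized Nash equilibrium problem defined by $X$ and $(u_i)_{i=1}^N$ has a solution.
   Context: A vector $x\in\mathbb{R}^n$ is written $x=(x_1,\dots,x_N)=(x_{-i},x_i)$ with $x_i\in\mathbb{R}^{n_i}$ the strategy of player $i$ and $x_{-i}\in\mathbb{R}^{n-n_i}$ the strategies of the other players. For given $x_{-i}$, the strategy set of player $i$ is $X_i(x_{-i})=\{x_i\in\mathbb{R}^{n_i}:(x_{-i},x_i)\in X\}$, and $Sol(x_{-i})$ denotes the set of minimizers of $u_i(x_{-i},\cdot)$ over $X_i(x_{-i})$. A solution (equilibrium) of the jointly convex generalized Nash equilibrium problem is a vector $\bar x\in\mathbb{R}^n$ with $\bar x_i\in Sol(\bar x_{-i})$ for all $i\in\{1,\dots,N\}$. Norms are Euclidean. *)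

theory Defs
  imports "HOL-Analysis.Analysis"
begin

text \<open>
  The splitting of n-space into N blocks, the i-th of dimension \<open>d i\<close>, is encoded by a map
  \<open>blk\<close> sending each coordinate to the player controlling it.  The strategy space of player i
  is the coordinate subspace of vectors supported on the i-th block, and the space of the
  rivals' strategies is the complementary coordinate subspace; \<open>profile blk i a v\<close> is the
  vector \<open>(x\<^sub>-\<^sub>i, x\<^sub>i)\<close> with \<open>x\<^sub>-\<^sub>i = a\<close> and \<open>x\<^sub>i = v\<close>.  A payoff on
  pairs \<open>(x\<^sub>-\<^sub>i, x\<^sub>i)\<close> is thereby a function on n-space.
\<close>

definition block_partition :: "nat \<Rightarrow> (nat \<Rightarrow> nat) \<Rightarrow> ('n::finite \<Rightarrow> nat) \<Rightarrow> bool" where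
  "block_partition N d blk \<longleftrightarrow>
     (\<forall>j. blk j \<in> {1..N}) \<and> (\<forall>i\<in>{1..N}. card {j. blk j = i} = d i)"

definition own_space :: "('n::finite \<Rightarrow> nat) \<Rightarrow> nat \<Rightarrow> (real ^ 'n) set" where
  "own_space blk i = {v. \<forall>j. blk j \<noteq> i \<longrightarrow> v $ j = 0}"

definition rival_space :: "('n::finite \<Rightarrow> nat) \<Rightarrow> nat \<Rightarrow> (real ^ 'n) set" where
  "rival_space blk i = {a. \<forall>j. blk j = i \<longrightarrow> a $ j = 0}"

definition own :: "('n::finite \<Rightarrow> nat) \<Rightarrow> nat \<Rightarrow> real ^ 'n \<Rightarrow> real ^ 'n" where
  "own blk i x = (\<chi> j. if blk j = i then x $ j else 0)"

definition rivals :: "('n::finite \<Rightarrow> nat) \<Rightarrow> nat \<Rightarrow> real ^ 'n \<Rightarrow> real ^ 'n" where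
  "rivals blk i x = (\<chi> j. if blk j = i then 0 else x $ j)"

definition profile :: "('n::finite \<Rightarrow> nat) \<Rightarrow> nat \<Rightarrow> real ^ 'n \<Rightarrow> real ^ 'n \<Rightarrow> real ^ 'n" where
  "profile blk i a v = (\<chi> j. if blk j = i then v $ j else a $ j)"

lemma own_in_own_space: "own blk i x \<in> own_space blk i"
  by (simp add: own_def own_space_def)

lemma rivals_in_rival_space: "rivals blk i x \<in> rival_space blk i"
  by (simp add: rivals_def rival_space_def)

lemma profile_rivals_own: "profile blk i (rivals blk i x) (own blk i x) = x"
  by (simp add: profile_def rivals_def own_def vec_eq_iff)

lemma rivals_profile: "a \<in> rival_space blk i \<Longrightarrow> rivals blk i (profile blk i a v) = a"
  by (auto simp: profile_def rivals_def rival_space_def vec_eq_iff)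

lemma own_profile: "v \<in> own_space blk i \<Longrightarrow> own blk i (profile blk i a v) = v"
  by (auto simp: profile_def own_def own_space_def vec_eq_iff)

definition quasiconvex_on :: "'a::real_vector set \<Rightarrow> ('a \<Rightarrow> real) \<Rightarrow> bool" where
  "quasiconvex_on S f \<longleftrightarrow> convex S \<and>
     (\<forall>x\<in>S. \<forall>y\<in>S. \<forall>t\<in>{0..1}. f ((1 - t) *\<^sub>R x + t *\<^sub>R y) \<le> max (f x) (f y))"

definition strategy_set ::
  "('n::finite \<Rightarrow> nat) \<Rightarrow> (real ^ 'n) set \<Rightarrow> nat \<Rightarrow> real ^ 'n \<Rightarrow> (real ^ 'n) set" where
  "strategy_set blk X i a = {v \<in> own_space blk i. profile blk i a v \<in> X}"

definition Sol ::
  "('n::finite \<Rightarrow> nat) \<Rightarrow> (real ^ 'n) set \<Rightarrow> (nat \<Rightarrow> real ^ 'n \<Rightarrow> real) \<Rightarrow> nat \<Rightarrow> real ^ 'n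
     \<Rightarrow> (real ^ 'n) set" where
  "Sol blk X u i a =
     {v. is_arg_min (\<lambda>w. u i (profile blk i a w)) (\<lambda>w. w \<in> strategy_set blk X i a) v}"

definition gnep_solution ::
  "nat \<Rightarrow> ('n::finite \<Rightarrow> nat) \<Rightarrow> (real ^ 'n) set \<Rightarrow> (nat \<Rightarrow> real ^ 'n \<Rightarrow> real) \<Rightarrow> real ^ 'n
     \<Rightarrow> bool" where
  "gnep_solution N blk X u x \<longleftrightarrow>
     (\<forall>i\<in>{1..N}. own blk i x \<in> Sol blk X u i (rivals blk i x))"

end

theory Submission
  imports Defs
begin

text \<open>
  Fix a profile \<open>x\<close>.  For each player take the unit vectors in his block that are normal at
  \<open>x\<close> to the set of his strictly better strategies; combining one per player gives a compact set
  of vectors \<open>w\<close> with closed graph in \<open>x\<close>.  The condition that \<open>w \<bullet> (z - x) < 0\<close> for all such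
  \<open>w\<close> is convex in \<open>z\<close>, open in \<open>x\<close>, and false for \<open>z = x\<close>.  Hence, by Browder's fixed point
  theorem on the intersection of \<open>X\<close> with a large ball, some \<open>x\<close> admits no \<open>z\<close> satisfying it.
  Since the better sets are open, \<open>w \<bullet> (z - x) < 0\<close> does hold when \<open>z\<close> is better than \<open>x\<close>
  for every player, so the coercivity assumption keeps \<open>x\<close> off the sphere; convexity then
  removes the ball, and testing with unilateral deviations shows that \<open>x\<close> is an equilibrium.
\<close>

section \<open>Browder's fixed point theorem\<close>

text \<open>By compactness finitely many fibres cover \<open>K\<close>. A partition of unity
  subordinate to them averages the corresponding points \<open>z\<close> into a continuous self-map
  of \<open>K\<close> that is a selection of \<open>F\<close>, because the values of
  \<open>F\<close> are convex. Brouwer's theorem applies to it.\<close>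

theorem browder_fixed_point:
  fixes K :: "'a::euclidean_space set" and F :: "'a \<Rightarrow> 'a set"
  assumes "compact K" "convex K" "K \<noteq> {}"
    and nonempty: "\<And>x. x \<in> K \<Longrightarrow> F x \<inter> K \<noteq> {}"
    and convex_values: "\<And>x. x \<in> K \<Longrightarrow> convex (F x)"
    and open_fibres: "\<And>z. z \<in> K \<Longrightarrow> openin (top_of_set K) {x \<in> K. z \<in> F x}"
  shows "\<exists>x\<in>K. x \<in> F x"
proof -
  obtain T where T: "\<And>z. z \<in> K \<Longrightarrow> open (T z)" "\<And>z. z \<in> K \<Longrightarrow> {x \<in> K. z \<in> F x} = K \<inter> T z"
    using open_fibres unfolding openin_open by metis
  obtain R where R: "K \<subseteq> ball 0 R"
    using \<open>compact K\<close> compact_imp_bounded bounded_subset_ballD by blast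
  \<comment> \<open>Cutting with a bounded ball makes every complement \<open>- V z\<close>
    nonempty. The infimum distance to an empty set is 0 by convention and would not detect
    membership in \<open>V z\<close>.\<close>
  define V where "V z = T z \<inter> ball 0 R" for z
  have oV: "open (V z)" if "z \<in> K" for z
    unfolding V_def using T(1)[OF that] by auto
  have V: "x \<in> V z \<longleftrightarrow> z \<in> F x" if "z \<in> K" "x \<in> K" for x z
    using T(2)[OF that(1)] R that unfolding V_def by blast
  have "bounded (V z)" for z
    unfolding V_def by auto
  then have ne: "- V z \<noteq> {}" for z
    using not_bounded_UNIV by (metis Compl_empty_eq double_compl)
  have cover: "K \<subseteq> (\<Union>z\<in>K. V z)"
    using nonempty V by blast
  obtain D where D: "D \<subseteq> K" "finite D" "K \<subseteq> (\<Union>z\<in>D. V z)"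
    using compactE_image[OF \<open>compact K\<close> _ cover] oV by metis
  define c where "c z x = infdist x (- V z)" for z x
  define f where "f x = (\<Sum>z\<in>D. (c z x / (\<Sum>y\<in>D. c y x)) *\<^sub>R z)" for x
  have c_nonneg: "c z x \<ge> 0" for z x
    unfolding c_def by (rule infdist_nonneg)
  have c_pos: "c z x > 0 \<longleftrightarrow> x \<in> V z" if "z \<in> D" for z x
  proof -
    have "closed (- V z)"
      using oV that D by auto
    then have "x \<in> - V z \<longleftrightarrow> c z x = 0"
      unfolding c_def using in_closed_iff_infdist_zero ne by metis
    then show ?thesis
      using c_nonneg[of z x] by auto
  qed
  have c_sum: "(\<Sum>y\<in>D. c y x) > 0" if x: "x \<in> K" for x
  proof -
    obtain z where "z \<in> D" "x \<in> V z"
      using D x by blast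
    then show ?thesis
      using c_pos c_nonneg D(2) by (meson sum_pos2)
  qed
  have weights: "(\<Sum>z\<in>D. c z x / (\<Sum>y\<in>D. c y x)) = 1" if "x \<in> K" for x
    using c_sum[OF that] by (simp add: sum_divide_distrib[symmetric])
  have "f \<in> K \<rightarrow> K"
  proof
    fix x assume "x \<in> K"
    then show "f x \<in> K"
      unfolding f_def using weights D c_nonneg c_sum \<open>convex K\<close>
      by (intro convex_sum) (auto simp: sum_nonneg)
  qed
  moreover have "continuous_on K f"
    unfolding f_def c_def using c_sum unfolding c_def
    by (intro continuous_intros) (metis less_irrefl)
  ultimately obtain x where x: "x \<in> K" "f x = x"
    using brouwer[OF \<open>compact K\<close> \<open>convex K\<close> \<open>K \<noteq> {}\<close>] by metis
  \<comment> \<open>Only the \<open>z\<close> with positive weight at \<open>x\<close> matter, and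
    all of these lie in \<open>F x\<close>.\<close>
  define D' where "D' = {z \<in> D. x \<in> V z}"
  have zero: "c z x = 0" if "z \<in> D - D'" for z
    using that c_pos[of z x] c_nonneg[of z x] unfolding D'_def by force
  have "f x = (\<Sum>z\<in>D'. (c z x / (\<Sum>y\<in>D. c y x)) *\<^sub>R z)"
    unfolding f_def by (rule sum.mono_neutral_right) (use D zero D'_def in auto)
  moreover have "(\<Sum>z\<in>D'. c z x / (\<Sum>y\<in>D. c y x)) = 1"
    unfolding weights[OF x(1), symmetric]
    by (rule sum.mono_neutral_left) (use D zero D'_def in auto)
  ultimately have "f x \<in> F x"
    using convex_values[OF x(1)] D V[OF _ x(1)] c_nonneg c_sum[OF x(1)]
    by (auto intro!: convex_sum simp: D'_def)
  then show ?thesis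
    using x by auto
qed

section \<open>Projections onto the blocks\<close>

lemma own_add: "own blk i (x + y) = own blk i x + own blk i y"
  and own_scaleR: "own blk i (c *\<^sub>R x) = c *\<^sub>R own blk i x"
  by (simp_all add: own_def vec_eq_iff)

lemma own_own: "own blk i (own blk j x) = (if i = j then own blk i x else 0)"
  by (auto simp: own_def vec_eq_iff)

lemma inner_own_left: "own blk i x \<bullet> y = own blk i x \<bullet> own blk i y"
  unfolding inner_vec_def own_def by (intro sum.cong) auto

lemma continuous_on_own [continuous_intros]:
  "continuous_on S f \<Longrightarrow> continuous_on S (\<lambda>x. own blk i (f x))"
  unfolding own_def
  by (intro continuous_on_vec_lambda, rename_tac j, case_tac "blk j = i")
    (auto intro!: continuous_intros)

lemma continuous_on_profile [continuous_intros]: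
  "continuous_on S f \<Longrightarrow> continuous_on S g \<Longrightarrow> continuous_on S (\<lambda>x. profile blk i (f x) (g x))"
  unfolding profile_def
  by (intro continuous_on_vec_lambda, rename_tac j, case_tac "blk j = i")
    (auto intro!: continuous_intros)

lemma sum_own:
  assumes "\<And>j. blk j \<in> {1..N}"
  shows "(\<Sum>i\<in>{1..N}. own blk i x) = x"
  using assms by (simp add: vec_eq_iff own_def sum.delta)

lemma profile_rivals [simp]: "profile blk i (rivals blk i x) v = profile blk i x v"
  and profile_own [simp]: "profile blk i a (own blk i v) = profile blk i a v"
  and profile_self [simp]: "profile blk i x x = x"
  and profile_profile [simp]: "profile blk i a (profile blk i b v) = profile blk i a v"
  by (auto simp: profile_def rivals_def own_def vec_eq_iff)

lemma profile_diff: "profile blk i x v - x = own blk i (v - x)"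
  by (simp add: profile_def own_def vec_eq_iff)

text \<open>Confines the unit normals at all points \<open>x\<close> to one ball, the compactness
  required for projecting their closed graph.\<close>

lemma norm_le_card_blocks:
  assumes "\<And>j. blk j \<in> {1..N}" and "\<And>i. i \<in> {1..N} \<Longrightarrow> norm (own blk i w) = 1"
  shows "norm w \<le> real N"
proof -
  have "norm w = norm (\<Sum>i\<in>{1..N}. own blk i w)"
    using sum_own[of blk N w, OF assms(1)] by simp
  also have "\<dots> \<le> (\<Sum>i\<in>{1..N}. norm (own blk i w))"
    by (rule norm_sum)
  also have "\<dots> = real N"
    using assms(2) by simp
  finally show ?thesis .
qed

section \<open>Better strategies and their unit normals\<close>

text \<open>A cylinder in the whole space, since only the \<open>i\<close>-th block of
  \<open>v\<close> matters. In this form it is open in the ambient space, not just relative to a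
  subspace.\<close>

definition better :: "('n::finite \<Rightarrow> nat) \<Rightarrow> (nat \<Rightarrow> real ^ 'n \<Rightarrow> real) \<Rightarrow> nat \<Rightarrow> real ^ 'n
    \<Rightarrow> (real ^ 'n) set" where
  "better blk u i x = {v. u i (profile blk i x v) < u i x}"

text \<open>One vector carries the normals of all players. Norm 1 in each block excludes the zero
  normal in a way that survives limits. The inequality is weak for the same reason.\<close>

definition unit_normals :: "nat \<Rightarrow> ('n::finite \<Rightarrow> nat) \<Rightarrow> (nat \<Rightarrow> real ^ 'n \<Rightarrow> real) \<Rightarrow> real ^ 'n
    \<Rightarrow> (real ^ 'n) set" where
  "unit_normals N blk u x = {w. \<forall>i\<in>{1..N}. norm (own blk i w) = 1 \<and>
     (\<forall>v\<in>better blk u i x. own blk i w \<bullet> (v - x) \<le> 0)}"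

lemma open_better:
  assumes "continuous_on UNIV (u i)"
  shows "open (better blk u i x)"
  unfolding better_def
  by (intro open_Collect_less continuous_intros continuous_on_compose2[OF assms]) auto

text \<open>A short move from \<open>v\<close> in direction \<open>a\<close> stays in
  \<open>S\<close> and strictly increases the inner product, so equality at \<open>v\<close> would
  violate the bound.\<close>

lemma inner_less_zero_if_open:
  fixes S :: "'a::real_inner set"
  assumes "open S" "v \<in> S" "a \<noteq> 0" and le: "\<And>v. v \<in> S \<Longrightarrow> a \<bullet> (v - x) \<le> 0"
  shows "a \<bullet> (v - x) < 0"
proof -
  obtain e where e: "e > 0" "cball v e \<subseteq> S"
    using assms open_contains_cball by metis
  define t where "t = e / norm a"
  have t: "t > 0"
    using e assms by (simp add: t_def)
  have "v + t *\<^sub>R a \<in> cball v e"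
    using e assms(3) by (simp add: dist_norm t_def)
  then have "a \<bullet> (v + t *\<^sub>R a - x) \<le> 0"
    using e le by blast
  moreover have "a \<bullet> (v + t *\<^sub>R a - x) = a \<bullet> (v - x) + t * (a \<bullet> a)"
    by (simp add: inner_diff_right inner_add_right algebra_simps)
  moreover have "t * (a \<bullet> a) > 0"
    using t assms(3) by simp
  ultimately show ?thesis
    by linarith
qed

text \<open>Strict sublevel sets of a quasiconvex function are convex. The hypothesis speaks of the
  own space only, so points are first projected to their block, which leaves \<open>profile\<close>
  unchanged.\<close>

lemma convex_better:
  assumes "\<And>a. a \<in> rival_space blk i \<Longrightarrow>
      quasiconvex_on (own_space blk i) (\<lambda>v. u i (profile blk i a v))"
  shows "convex (better blk u i x)"
proof (rule convexI)
  fix v w and s t :: real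
  assume *: "v \<in> better blk u i x" "w \<in> better blk u i x" "0 \<le> s" "0 \<le> t" "s + t = 1"
  have s: "s = 1 - t" "t \<in> {0..1}"
    using * by auto
  have "u i (profile blk i (rivals blk i x) ((1 - t) *\<^sub>R own blk i v + t *\<^sub>R own blk i w)) \<le>
     max (u i (profile blk i (rivals blk i x) (own blk i v)))
         (u i (profile blk i (rivals blk i x) (own blk i w)))"
    using assms[OF rivals_in_rival_space[of blk i x]] s own_in_own_space
    unfolding quasiconvex_on_def by blast
  also have "(1 - t) *\<^sub>R own blk i v + t *\<^sub>R own blk i w = own blk i (s *\<^sub>R v + t *\<^sub>R w)"
    by (simp add: own_add own_scaleR s)
  finally show "s *\<^sub>R v + t *\<^sub>R w \<in> better blk u i x"
    using * by (auto simp: better_def)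
qed

text \<open>If there are better strategies, a hyperplane separates them from \<open>x\<close>, and
  its normal is projected to the block and normalized. If there are none, any unit vector of the
  block will do.\<close>

lemma own_unit_normal_exists:
  assumes "card {j. blk j = i} > 0" and cont: "continuous_on UNIV (u i)"
    and "\<And>a. a \<in> rival_space blk i \<Longrightarrow>
      quasiconvex_on (own_space blk i) (\<lambda>v. u i (profile blk i a v))"
  shows "\<exists>a. norm (own blk i a) = 1 \<and> (\<forall>v\<in>better blk u i x. own blk i a \<bullet> (v - x) \<le> 0)"
proof (cases "better blk u i x = {}")
  case True
  obtain j where j: "blk j = i"
    using assms(1) by (auto simp: card_gt_0_iff)
  have "own blk i (axis j 1) = axis j 1"
    using j by (auto simp: own_def axis_def vec_eq_iff)
  then show ?thesis
    using True by (intro exI[of _ "axis j 1"]) simp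
next
  case False
  let ?S = "better blk u i x"
  have "convex ((\<lambda>v. v - x) ` ?S)"
    using convex_better[where u = u and i = i] assms(3) by (intro convex_translation_subtract) blast
  moreover have "0 \<notin> (\<lambda>v. v - x) ` ?S"
    by (auto simp: better_def)
  ultimately obtain a where a: "a \<noteq> 0" "\<And>v. v \<in> ?S \<Longrightarrow> 0 \<le> a \<bullet> (v - x)"
    using separating_hyperplane_set_0 by (metis (no_types, lifting) imageI)
  \<comment> \<open>The point \<open>profile blk i x v\<close> is also better and differs from
    \<open>x\<close> in block \<open>i\<close> only, so it tests just that block of
    \<open>a\<close>. Strictness, from openness, then shows that the projected normal is
    nonzero.\<close>
  have neg: "own blk i (- a) \<bullet> (v - x) < 0" if v: "v \<in> ?S" for v
  proof -
    have "profile blk i x v \<in> ?S"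
      using v by (simp add: better_def)
    then have "(- a) \<bullet> (profile blk i x v - x) < 0"
      by (rule inner_less_zero_if_open[OF open_better[of u i, OF cont]]) (use a in auto)
    then show ?thesis
      by (metis profile_diff inner_own_left inner_commute)
  qed
  define b where "b = own blk i (- a)"
  have "b \<noteq> 0"
    using False neg unfolding b_def by fastforce
  moreover have "own blk i ((1 / norm b) *\<^sub>R b) = (1 / norm b) *\<^sub>R b"
    by (simp add: own_scaleR b_def own_own)
  moreover have "((1 / norm b) *\<^sub>R b) \<bullet> (v - x) \<le> 0" if "v \<in> ?S" for v
    using neg[OF that] unfolding b_def[symmetric] by (simp add: divide_nonpos_nonneg)
  ultimately show ?thesis
    by (intro exI[of _ "(1 / norm b) *\<^sub>R b"]) simp
qed

lemma unit_normals_nonempty: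
  assumes "\<And>i. i \<in> {1..N} \<Longrightarrow> card {j. blk j = i} > 0"
    and "\<And>i. i \<in> {1..N} \<Longrightarrow> continuous_on UNIV (u i)"
    and "\<And>i a. i \<in> {1..N} \<Longrightarrow> a \<in> rival_space blk i \<Longrightarrow>
      quasiconvex_on (own_space blk i) (\<lambda>v. u i (profile blk i a v))"
  shows "unit_normals N blk u x \<noteq> {}"
proof -
  have "\<exists>a. norm (own blk i a) = 1 \<and> (\<forall>v\<in>better blk u i x. own blk i a \<bullet> (v - x) \<le> 0)"
    if "i \<in> {1..N}" for i
    using that by (intro own_unit_normal_exists assms)
  then obtain a where a: "\<And>i. i \<in> {1..N} \<Longrightarrow> norm (own blk i (a i)) = 1"
    "\<And>i v. i \<in> {1..N} \<Longrightarrow> v \<in> better blk u i x \<Longrightarrow> own blk i (a i) \<bullet> (v - x) \<le> 0"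
    by metis
  \<comment> \<open>The blocks are disjoint, so the players' normals can be glued
    coordinatewise.\<close>
  define w where "w = (\<chi> j. a (blk j) $ j)"
  have "own blk i w = own blk i (a i)" for i
    by (simp add: w_def own_def vec_eq_iff)
  then have "w \<in> unit_normals N blk u x"
    using a by (simp add: unit_normals_def)
  then show ?thesis
    by blast
qed

text \<open>For fixed \<open>v\<close>, being better is an open condition on \<open>x\<close>. The
  implication from it to a weak inequality is therefore a union of two closed conditions.\<close>

lemma closed_unit_normals_graph:
  assumes "\<And>i. i \<in> {1..N} \<Longrightarrow> continuous_on UNIV (u i)"
  shows "closed {(w, x). w \<in> unit_normals N blk u x}"
proof -
  have "{(w, x). w \<in> unit_normals N blk u x} =
    (\<Inter>i\<in>{1..N}. {p. norm (own blk i (fst p)) = 1} \<inter>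
      (\<Inter>v. {p. u i (snd p) \<le> u i (profile blk i (snd p) v)} \<union>
          {p. own blk i (fst p) \<bullet> (v - snd p) \<le> 0}))"
    unfolding unit_normals_def better_def by (auto simp: not_less[symmetric])
  also have "closed \<dots>"
    by (intro closed_INT closed_Int closed_Un ballI closed_Collect_le closed_Collect_eq
        continuous_intros continuous_on_compose2[OF assms]) auto
  finally show ?thesis .
qed

text \<open>Openness of the better set recovers the strict inequality that the definition gives up
  in order to have a closed graph.\<close>

lemma unit_normal_strict:
  assumes "w \<in> unit_normals N blk u x" "i \<in> {1..N}" "v \<in> better blk u i x"
    and "continuous_on UNIV (u i)"
  shows "own blk i w \<bullet> (v - x) < 0"
proof (rule inner_less_zero_if_open[OF open_better[of u i, OF assms(4)] assms(3)])
  show "own blk i w \<noteq> 0"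
    using assms by (force simp: unit_normals_def)
qed (use assms in \<open>auto simp: unit_normals_def\<close>)

text \<open>The conclusion is a Ky Fan type weakening of the variational inequality for the unit
  normals: the normal \<open>w\<close> may depend on \<open>z\<close>, so no minimax argument is needed.\<close>

lemma variational_point_exists:
  assumes blk: "\<And>j. blk j \<in> {1..N}"
    and "\<And>i. i \<in> {1..N} \<Longrightarrow> card {j. blk j = i} > 0"
    and cont: "\<And>i. i \<in> {1..N} \<Longrightarrow> continuous_on UNIV (u i)"
    and "\<And>i a. i \<in> {1..N} \<Longrightarrow> a \<in> rival_space blk i \<Longrightarrow>
      quasiconvex_on (own_space blk i) (\<lambda>v. u i (profile blk i a v))"
    and "compact K" "convex K" "K \<noteq> {}"
  obtains x where "x \<in> K" "\<And>z. z \<in> K \<Longrightarrow> \<exists>w\<in>unit_normals N blk u x. w \<bullet> (z - x) \<ge> 0"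
proof -
  define F where "F x = {z. \<forall>w\<in>unit_normals N blk u x. w \<bullet> (z - x) < 0}" for x
  have "convex (F x)" for x
  proof -
    have "F x = (\<Inter>w\<in>unit_normals N blk u x. {z. w \<bullet> z < w \<bullet> x})"
      by (auto simp: F_def inner_diff_right)
    then show ?thesis
      by (auto intro!: convex_INT convex_halfspace_lt)
  qed
  moreover have "openin (top_of_set K) {x \<in> K. z \<in> F x}" for z
  proof -
    \<comment> \<open>The complement of the fibre is the projection to \<open>x\<close> of a closed
      set whose \<open>w\<close>-component stays in a compact ball, hence closed.\<close>
    have "closed ({(w, x). w \<in> unit_normals N blk u x} \<inter> {p. fst p \<bullet> (z - snd p) \<ge> 0})"
      by (intro closed_Int closed_unit_normals_graph[OF cont] closed_Collect_le continuous_intros)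
    then have "closed {x. \<exists>w. w \<in> cball 0 (real N) \<and>
        (w, x) \<in> {(w, x). w \<in> unit_normals N blk u x} \<inter> {p. fst p \<bullet> (z - snd p) \<ge> 0}}"
      by (intro closed_compact_projection compact_cball)
    moreover have "\<dots> = - {x. z \<in> F x}"
      using norm_le_card_blocks[of blk N, OF blk] by (fastforce simp: F_def unit_normals_def)
    ultimately have "open {x. z \<in> F x}"
      by (metis closed_def double_compl)
    moreover have "{x \<in> K. z \<in> F x} = K \<inter> {x. z \<in> F x}"
      by auto
    ultimately show ?thesis
      by (metis openin_open_Int)
  qed
  \<comment> \<open>For \<open>z = x\<close> the condition would read 0 < 0 for some existing
    normal.\<close>
  moreover have "x \<notin> F x" for x
    using unit_normals_nonempty[of N blk u x] assms by (auto simp: F_def)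
  \<comment> \<open>There is no fixed point, so of the hypotheses of Browder's theorem it is
    nonemptiness of \<open>F x \<inter> K\<close> that fails somewhere.\<close>
  ultimately obtain x where "x \<in> K" "F x \<inter> K = {}"
    using browder_fixed_point[of K F] assms(5-7) by blast
  then have "\<exists>w\<in>unit_normals N blk u x. w \<bullet> (z - x) \<ge> 0" if "z \<in> K" for z
    using that by (fastforce simp: F_def disjoint_iff not_less[symmetric])
  then show ?thesis
    using \<open>x \<in> K\<close> that by blast
qed

section \<open>From the variational point to an equilibrium\<close>

lemma own_in_Sol:
  assumes "x \<in> X" and "\<And>v. v \<in> better blk u i x \<Longrightarrow> profile blk i x v \<notin> X"
  shows "own blk i x \<in> Sol blk X u i (rivals blk i x)"
  using assms own_in_own_space[of blk i x]
  by (auto simp: Sol_def is_arg_min_def strategy_set_def better_def)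

theorem theorem4p2:
  fixes N :: nat and d :: "nat \<Rightarrow> nat" and blk :: "'n::finite \<Rightarrow> nat"
    and X :: "(real ^ 'n) set" and u :: "nat \<Rightarrow> real ^ 'n \<Rightarrow> real"
  assumes "\<And>i. i \<in> {1..N} \<Longrightarrow> 0 < d i"
    and "(\<Sum>i=1..N. d i) = CARD('n)"
    and "block_partition N d blk"
    and "X \<noteq> {}" and "closed X" and "convex X"
    and "\<And>i. i \<in> {1..N} \<Longrightarrow> continuous_on UNIV (u i)"
    and "\<And>i a. \<lbrakk>i \<in> {1..N}; a \<in> rival_space blk i\<rbrakk>
           \<Longrightarrow> quasiconvex_on (own_space blk i) (\<lambda>v. u i (profile blk i a v))"
    and "\<exists>r'>0. \<forall>y\<in>X. r' < norm y \<longrightarrow>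
           (\<exists>z\<in>X. norm z < norm y \<and>
             (\<forall>i\<in>{1..N}. u i (profile blk i (rivals blk i y) (own blk i z))
                        < u i (profile blk i (rivals blk i y) (own blk i y))))"
  shows "\<exists>x. gnep_solution N blk X u x"
proof -
  have blk: "\<And>j. blk j \<in> {1..N}" and card: "\<And>i. i \<in> {1..N} \<Longrightarrow> card {j. blk j = i} > 0"
    using assms(1,3) by (auto simp: block_partition_def)
  \<comment> \<open>The type of coordinates is inhabited, and each coordinate has an owner.\<close>
  then have N: "{1..N} \<noteq> {}"
    by blast
  obtain r' where r': "\<And>y. y \<in> X \<Longrightarrow> r' < norm y \<Longrightarrow>
      \<exists>z\<in>X. norm z < norm y \<and> (\<forall>i\<in>{1..N}. z \<in> better blk u i y)"
    using assms(9) by (auto simp: better_def)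
  obtain x0 where x0: "x0 \<in> X"
    using assms(4) by blast
  \<comment> \<open>Larger than \<open>r'\<close>, so that coercivity applies on the sphere of
    radius \<open>r\<close>, and at least \<open>norm x0\<close>, so that \<open>K\<close> contains
    \<open>x0\<close>.\<close>
  define r where "r = max (r' + 1) (norm x0)"
  define K where "K = X \<inter> cball 0 r"
  have "compact K" "convex K" "K \<noteq> {}"
    using assms(5,6) x0 by (auto simp: K_def closed_Int_compact convex_Int r_def)
  then obtain x where x: "x \<in> K"
      "\<And>z. z \<in> K \<Longrightarrow> \<exists>w\<in>unit_normals N blk u x. w \<bullet> (z - x) \<ge> 0"
    using variational_point_exists[of blk N u K] blk card assms(7,8) by metis
  have "norm x < r"
  proof (rule ccontr)
    assume "\<not> norm x < r"
    then have "norm x = r" "r' < norm x"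
      using x(1) by (auto simp: K_def r_def)
    then obtain z where z: "z \<in> X" "norm z < r" "\<And>i. i \<in> {1..N} \<Longrightarrow> z \<in> better blk u i x"
      using r'[of x] x(1) by (auto simp: K_def)
    then obtain w where w: "w \<in> unit_normals N blk u x" "w \<bullet> (z - x) \<ge> 0"
      using x(2)[of z] by (auto simp: K_def)
    \<comment> \<open>Split over the players, every term is negative because \<open>z\<close> is
      better for each of them.\<close>
    have "w \<bullet> (z - x) = (\<Sum>i\<in>{1..N}. own blk i w \<bullet> (z - x))"
      unfolding inner_sum_left[symmetric] by (subst sum_own[OF blk]) (rule refl)
    also have "\<dots> < (\<Sum>i\<in>{1..N}. 0)"
      by (intro sum_strict_mono finite_atLeastAtMost N unit_normal_strict[OF w(1)] z(3) assms(7))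
    finally show False
      using w(2) by simp
  qed
  have global: "\<exists>w\<in>unit_normals N blk u x. w \<bullet> (z - x) \<ge> 0" if z: "z \<in> X" for z
  proof -
    \<comment> \<open>A step towards \<open>z\<close> short enough to stay in the ball, which is
      possible because \<open>x\<close> lies in its interior. The added 1 keeps the denominator
      positive when \<open>z = x\<close>.\<close>
    define t where "t = min 1 ((r - norm x) / (norm (z - x) + 1))"
    have t: "0 < t" "t \<le> 1" "t * norm (z - x) \<le> r - norm x"
    proof -
      have p: "norm (z - x) + 1 > 0"
        by (smt (verit) norm_ge_zero)
      then show "0 < t" "t \<le> 1"
        using \<open>norm x < r\<close> by (auto simp: t_def)
      have "t * norm (z - x) \<le> t * (norm (z - x) + 1)"
        using \<open>0 < t\<close> by simp
      also have "\<dots> \<le> (r - norm x) / (norm (z - x) + 1) * (norm (z - x) + 1)"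
        using p by (intro mult_right_mono) (auto simp: t_def)
      also have "\<dots> = r - norm x"
        using p by simp
      finally show "t * norm (z - x) \<le> r - norm x" .
    qed
    have "x + t *\<^sub>R (z - x) \<in> X"
      using convexD_alt[OF assms(6), of x z t] x(1) z t by (auto simp: K_def algebra_simps)
    moreover have "norm (x + t *\<^sub>R (z - x)) \<le> r"
      using norm_triangle_ineq[of x "t *\<^sub>R (z - x)"] t by simp
    ultimately obtain w where "w \<in> unit_normals N blk u x" "w \<bullet> (x + t *\<^sub>R (z - x) - x) \<ge> 0"
      using x(2)[of "x + t *\<^sub>R (z - x)"] by (auto simp: K_def)
    \<comment> \<open>The inner product at the intermediate point is \<open>t\<close> times the one
      at \<open>z\<close>, and \<open>t\<close> is positive.\<close>
    then show ?thesis
      using t(1) by (auto simp: zero_le_mult_iff)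
  qed
  have "own blk i x \<in> Sol blk X u i (rivals blk i x)" if i: "i \<in> {1..N}" for i
  proof (rule own_in_Sol)
    fix v assume v: "v \<in> better blk u i x"
    show "profile blk i x v \<notin> X"
    proof
      assume "profile blk i x v \<in> X"
      then obtain w where w: "w \<in> unit_normals N blk u x" "w \<bullet> (profile blk i x v - x) \<ge> 0"
        using global by blast
      \<comment> \<open>A unilateral deviation moves only block \<open>i\<close>, so the other
        blocks of \<open>w\<close> contribute nothing.\<close>
      have "w \<bullet> (profile blk i x v - x) = own blk i w \<bullet> (v - x)"
        by (metis profile_diff inner_own_left inner_commute)
      also have "\<dots> < 0"
        using unit_normal_strict[OF w(1) i v assms(7)[OF i]] .
      finally show False
        using w(2) by simp
    qed
  qed (use x in \<open>auto simp: K_def\<close>)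
  then show ?thesis
    unfolding gnep_solution_def by blast
qed

end
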